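(* Let $A$ be a fixed zero-diagonal representative of an $\mathrm{SBIBD}(v,k,\lambda)$. For $p=1$ (assuming $k\ge 1$), $$q^*(A,1)=1.$$ For every integer $p\ge 2$ with $k\ge\lambda(p-1)+2$, $$\max\{p,\lambda+1\}\le q^*(A,p)\le\lambda(p-1)+2.$$ In particular (for $p=2$, $k\ge\lambda+2$), $\lambda+1\le q^*(A,2)\le\lambda+2$.
   Context: Symmetric design. For integers $1\le\lambda<k<v$, an $\mathrm{SBIBD}(v,k,\lambda)$ consists of $v$ points and $v$ blocks such that every block contains $k$ points, every point lies in $k$ blocks, and every two distinct points lie together in exactly $\lambda$ blocks. After independently labeling points and blocks by $0,1,\dots,v-1$, the incidence matrix $A=(A_{ij})\in\{0,1\}^{v\times v}$, with $A_{ij}=1$ iff point $i$ lies in block $j$, is called a representative of the SBIBD. It is zero-diagonal if $A_{ii}=0$ for all $i$. Coding model. There are $v$ nodes $0,\dots,v-1$. For a node $i$ let $\mathcal S_{\mathrm{tgt}}(i)=\{j:A_{ij}=1\}$ (admissible targets) and $\mathcal S_{\mathrm{src}}(i)=\{h:A_{hi}=1\}$ (sources); both have size $k$. There is a finite collection of data objects, each a binary word of one common positive length; $\oplus$ is componentwise addition over $\mathbb F_2$. Each object $x$ has exactly one primary copy, stored at its primary node $i$, and for the replica count $q\in\{0,\dots,k\}$ it selects a set $T_x\subseteq\mathcal S_{\mathrm{tgt}}(i)$ of exactly $q$ distinct target nodes (chosen separately for each object) and sends one replica to each node in $T_x$. A placement is legal if at each node $j$ the replicas received at $j$ are partitioned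 into $k$-tuples, each containing exactly one replica from every primary node in $\mathcal S_{\mathrm{src}}(j)$ (the partition is part of the placement). For each such tuple, consisting of objects $x_1,\dots,x_k$, node $j$ stores one parity $x_1\oplus\cdots\oplus x_k$; the replicas are then discarded. Failures and recovery. Given a set $F$ of failed nodes, all primary copies and parities stored at nodes of $F$ are lost, and those stored at other nodes are alive. A placement permits recovery from $F$ if the values of all objects whose primary node is in $F$ are uniquely determined by the alive primary copies and the alive parities (the placement being known). Universal replica threshold. For an integer $p\ge1$, $q^*(A,p)$ is the smallest integer $q\in\{0,1,\dots,k\}$ such that every legal placement of any finite object collection using exactly $q$ target nodes per object permits recovery from every set of at most $p$ failed nodes. *)

theory Defs
  imports "Jordan_Normal_Form.Matrix" "HOL-Library.Z2" "HOL-Library.Disjoint_Sets"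
begin

text \<open>
  Blocks are abstract and related to points by an incidence relation, so that their being
  distinct as point sets is not part of the definition.
\<close>

definition sbibd ::
  "nat \<Rightarrow> nat \<Rightarrow> nat \<Rightarrow> 'a set \<Rightarrow> 'b set \<Rightarrow> ('a \<Rightarrow> 'b \<Rightarrow> bool) \<Rightarrow> bool" where
  "sbibd v k l points blocks lies_in \<longleftrightarrow>
     1 \<le> l \<and> l < k \<and> k < v \<and>
     finite points \<and> card points = v \<and>
     finite blocks \<and> card blocks = v \<and>
     (\<forall>b\<in>blocks. card {x \<in> points. lies_in x b} = k) \<and>
     (\<forall>x\<in>points. card {b \<in> blocks. lies_in x b} = k) \<and>
     (\<forall>x\<in>points. \<forall>y\<in>points. x \<noteq> y \<longrightarrow>
        card {b \<in> blocks. lies_in x b \<and> lies_in y b} = l)"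

definition representative ::
  "nat \<Rightarrow> 'a set \<Rightarrow> 'b set \<Rightarrow> ('a \<Rightarrow> 'b \<Rightarrow> bool) \<Rightarrow> nat mat \<Rightarrow> bool" where
  "representative v points blocks lies_in A \<longleftrightarrow>
     A \<in> carrier_mat v v \<and>
     (\<exists>pt bl. bij_betw pt {..<v} points \<and> bij_betw bl {..<v} blocks \<and>
        (\<forall>i<v. \<forall>j<v. A $$ (i, j) = (if lies_in (pt i) (bl j) then 1 else 0)))"

definition zero_diagonal :: "nat mat \<Rightarrow> bool" where
  "zero_diagonal A \<longleftrightarrow> (\<forall>i<dim_row A. A $$ (i, i) = 0)"

definition S_tgt :: "nat mat \<Rightarrow> nat \<Rightarrow> nat set" where
  "S_tgt A i = {j. j < dim_col A \<and> A $$ (i, j) = 1}"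

definition S_src :: "nat mat \<Rightarrow> nat \<Rightarrow> nat set" where
  "S_src A i = {h. h < dim_row A \<and> A $$ (h, i) = 1}"

text \<open>
  A finite object collection together with its placement. Objects are named by natural numbers,
  which is no restriction for finite collections. Since the targets of an object form a set, a
  node receives at most one replica of each object; a replica received at a node is therefore
  identified with its object, and a tuple of replicas with a set of objects.
\<close>

record placement =
  word_length :: nat
  objects :: "nat set"
  primary :: "nat \<Rightarrow> nat"
  targets :: "nat \<Rightarrow> nat set"
  tuples :: "nat \<Rightarrow> nat set set"

definition received :: "placement \<Rightarrow> nat \<Rightarrow> nat set" where
  "received P j = {x \<in> objects P. j \<in> targets P x}"

definition legal_placement :: "nat mat \<Rightarrow> nat \<Rightarrow> nat \<Rightarrow> placement \<Rightarrow> bool" where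
  "legal_placement A k q P \<longleftrightarrow>
     0 < word_length P \<and> finite (objects P) \<and>
     (\<forall>x\<in>objects P. primary P x < dim_row A \<and>
        targets P x \<subseteq> S_tgt A (primary P x) \<and> card (targets P x) = q) \<and>
     (\<forall>j<dim_row A. partition_on (received P j) (tuples P j) \<and>
        (\<forall>G\<in>tuples P j. card G = k \<and>
           (\<forall>h\<in>S_src A j. \<exists>!x. x \<in> G \<and> primary P x = h)))"

definition data_assignment :: "placement \<Rightarrow> (nat \<Rightarrow> bit list) \<Rightarrow> bool" where
  "data_assignment P w \<longleftrightarrow> (\<forall>x\<in>objects P. length (w x) = word_length P)"

definition parity :: "placement \<Rightarrow> (nat \<Rightarrow> bit list) \<Rightarrow> nat set \<Rightarrow> bit list" where
  "parity P w G = map (\<lambda>t. \<Sum>x\<in>G. w x ! t) [0..<word_length P]"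

text \<open>
  Unique determination: any two data assignments that agree on everything alive agree on
  every object whose primary copy is lost.
\<close>

definition permits_recovery :: "nat mat \<Rightarrow> placement \<Rightarrow> nat set \<Rightarrow> bool" where
  "permits_recovery A P F \<longleftrightarrow>
     (\<forall>w w'. data_assignment P w \<and> data_assignment P w' \<and>
        (\<forall>x\<in>objects P. primary P x \<notin> F \<longrightarrow> w x = w' x) \<and>
        (\<forall>j<dim_row A. j \<notin> F \<longrightarrow> (\<forall>G\<in>tuples P j. parity P w G = parity P w' G)) \<longrightarrow>
        (\<forall>x\<in>objects P. primary P x \<in> F \<longrightarrow> w x = w' x))"

definition universally_recoverable :: "nat mat \<Rightarrow> nat \<Rightarrow> nat \<Rightarrow> nat \<Rightarrow> bool" where
  "universally_recoverable A k p q \<longleftrightarrow>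
     (\<forall>P. legal_placement A k q P \<longrightarrow>
        (\<forall>F. F \<subseteq> {..<dim_row A} \<and> card F \<le> p \<longrightarrow> permits_recovery A P F))"

text \<open>
  The threshold need not exist for every \<open>p\<close>, and the value of \<open>LEAST\<close> is meaningful only if
  it does; existence is therefore a separate predicate, to be asserted along with any claim about
  the value. The design parameter \<open>k\<close> is passed explicitly, although \<open>A\<close> determines it.
\<close>

definition threshold_exists :: "nat mat \<Rightarrow> nat \<Rightarrow> nat \<Rightarrow> bool" where
  "threshold_exists A k p \<longleftrightarrow> (\<exists>q\<in>{0..k}. universally_recoverable A k p q)"

definition q_star :: "nat mat \<Rightarrow> nat \<Rightarrow> nat \<Rightarrow> nat" where
  "q_star A k p = (LEAST q. q \<in> {0..k} \<and> universally_recoverable A k p q)"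

end

theory Submission
  imports Defs
begin

text \<open>
  Upper bound: if recovery fails, let \<open>I\<close> be the set of primary nodes of the ambiguous objects.
  Every target of an ambiguous object with primary node \<open>i\<close> has either failed or is also a target
  of another node of \<open>I\<close>. There are at most \<open>l * (card I - 1)\<close> targets of the second kind, so at
  least \<open>q - l * (card I - 1)\<close> failed nodes are targets of \<open>i\<close> but of no other node of \<open>I\<close>. For
  distinct \<open>i\<close> these are disjoint sets of failed nodes, of which there are at most \<open>p\<close>.

  Lower bounds: in the complete placement, which has one object for every node \<open>i\<close> and every
  \<open>q\<close>-set of targets of \<open>i\<close>, every node receives equally many replicas from each of its
  sources. If \<open>q < p\<close>, let a node \<open>i\<close> and all \<open>q\<close> targets of one of its objects fail. If
  \<open>q \<le> l\<close>, let two nodes fail that have objects with the same \<open>q\<close> targets, and form the tuples so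
  that these two objects always occur together.
\<close>

section \<open>Counting, and a criterion for lost data\<close>

lemma of_nat_even_bit:
  assumes "even n"
  shows "(of_nat n :: bit) = 0"
proof -
  obtain m where "n = m + m"
    using assms by (metis evenE mult_2)
  then show ?thesis by simp
qed

text \<open>Composing any enumeration with the transposition of 0 and the index of \<open>y\<close>
  brings \<open>y\<close> to the front. This later forces chosen objects into the tuple with index
  0.\<close>

lemma bij_betw_lessThan_card:
  assumes "finite B"
  shows "\<exists>b. bij_betw b {..<card B} B \<and> (y \<in> B \<longrightarrow> b 0 = y)"
proof -
  obtain f where f: "bij_betw f {..<card B} B"
    using ex_bij_betw_nat_finite[OF assms] by (auto simp: atLeast0LessThan)
  show ?thesis
  proof (cases "y \<in> B")
    case True
    then obtain m where m: "m < card B" "f m = y"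
      using f unfolding bij_betw_def by (metis imageE lessThan_iff)
    have "bij_betw (f \<circ> Transposition.transpose 0 m) {..<card B} B"
      by (rule bij_betw_trans[OF _ f]) (use m in \<open>auto simp: bij_betw_transpose_iff\<close>)
    moreover have "(f \<circ> Transposition.transpose 0 m) 0 = y"
      using m by simp
    ultimately show ?thesis by blast
  next
    case False
    then show ?thesis using f by blast
  qed
qed

text \<open>Inserting \<open>j\<close> is a bijection from the \<open>q\<close>-subsets of
  \<open>S - {j}\<close>. The count depends on \<open>card S\<close> and \<open>q\<close> only,
  which makes replica counts equal across sources.\<close>

lemma card_subsets_containing:
  assumes "finite S" "j \<in> S"
  shows "card {T. T \<subseteq> S \<and> card T = Suc q \<and> j \<in> T} = (card S - 1) choose q"
proof -
  have "bij_betw (insert j) {T. T \<subseteq> S - {j} \<and> card T = q}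
          {T. T \<subseteq> S \<and> card T = Suc q \<and> j \<in> T}"
  proof (rule bij_betw_byWitness[where f' = "\<lambda>T. T - {j}"])
    show "insert j ` {T. T \<subseteq> S - {j} \<and> card T = q} \<subseteq> {T. T \<subseteq> S \<and> card T = Suc q \<and> j \<in> T}"
    proof clarify
      fix T assume T: "T \<subseteq> S - {j}" "q = card T"
      then have "finite T" "j \<notin> T"
        using assms(1) by (auto intro: finite_subset)
      then show "insert j T \<subseteq> S \<and> card (insert j T) = Suc (card T) \<and> j \<in> insert j T"
        using T assms(2) by auto
    qed
  qed (use assms in auto)
  then show ?thesis
    using n_subsets[of "S - {j}" q] assms by (simp add: bij_betw_same_card[symmetric])
qed

text \<open>The all-zero assignment and the indicator of \<open>D\<close> look the same from outside
  \<open>F\<close>: they differ only on lost primary copies, and each alive parity sums an even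
  number of ones.\<close>

lemma not_permits_recoveryI:
  assumes "word_length P = 1"
    and D: "D \<subseteq> objects P" "D \<noteq> {}" "\<And>x. x \<in> D \<Longrightarrow> primary P x \<in> F"
    and fin: "\<And>j G. j < dim_row A \<Longrightarrow> G \<in> tuples P j \<Longrightarrow> finite G"
    and ev: "\<And>j G. j < dim_row A \<Longrightarrow> j \<notin> F \<Longrightarrow> G \<in> tuples P j \<Longrightarrow> even (card (G \<inter> D))"
  shows "\<not> permits_recovery A P F"
proof
  define w w' :: "nat \<Rightarrow> bit list"
    where "w = (\<lambda>_. [0])" and "w' = (\<lambda>x. [if x \<in> D then 1 else 0])"
  assume "permits_recovery A P F"
  moreover have "data_assignment P w" "data_assignment P w'"
    using assms(1) by (auto simp: data_assignment_def w_def w'_def)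
  moreover have "\<forall>x\<in>objects P. primary P x \<notin> F \<longrightarrow> w x = w' x"
    using D(3) by (auto simp: w_def w'_def)
  moreover have "parity P w G = parity P w' G"
    if "j < dim_row A" "j \<notin> F" "G \<in> tuples P j" for j G
  proof -
    have "(\<Sum>x\<in>G. if x \<in> D then 1 else 0 :: bit) = of_nat (card (G \<inter> D))"
      using fin[OF that(1,3)] by (simp add: sum.If_cases)
    then have "(\<Sum>x\<in>G. if x \<in> D then 1 else 0 :: bit) = 0"
      using ev[OF that] by (simp add: of_nat_even_bit)
    then show ?thesis
      using assms(1) by (simp add: parity_def w_def w'_def)
  qed
  ultimately have "\<forall>x\<in>objects P. primary P x \<in> F \<longrightarrow> w x = w' x"
    unfolding permits_recovery_def by blast
  moreover obtain x where "x \<in> D"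
    using D(2) by blast
  ultimately have "w x = w' x"
    using D by blast
  then show False
    using \<open>x \<in> D\<close> by (simp add: w_def w'_def)
qed

section \<open>The design in terms of targets and sources\<close>

text \<open>The design axioms read off the matrix: points become rows, hence target sets, and blocks
  become columns, hence source sets. The zero diagonal becomes
  \<open>not_own_target\<close>.\<close>

locale zero_diagonal_design =
  fixes A :: "nat mat" and v k l :: nat
  assumes carrier: "A \<in> carrier_mat v v"
    and parameters: "1 \<le> l" "l < k" "k < v"
    and card_S_tgt: "\<And>i. i < v \<Longrightarrow> card (S_tgt A i) = k"
    and card_S_src: "\<And>j. j < v \<Longrightarrow> card (S_src A j) = k"
    and card_common_targets:
      "\<And>i i'. i < v \<Longrightarrow> i' < v \<Longrightarrow> i \<noteq> i' \<Longrightarrow> card (S_tgt A i \<inter> S_tgt A i') = l"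
    and not_own_target: "\<And>i. i \<notin> S_tgt A i"
begin

lemma dim_A [simp]: "dim_row A = v" "dim_col A = v"
  using carrier by auto

lemma S_tgt_less: "j \<in> S_tgt A i \<Longrightarrow> j < v"
  by (simp add: S_tgt_def)

lemma finite_S_tgt [simp]: "finite (S_tgt A i)"
  by (simp add: S_tgt_def)

lemma finite_S_src [simp]: "finite (S_src A j)"
  by (simp add: S_src_def)

lemma S_src_iff: "j < v \<Longrightarrow> i \<in> S_src A j \<longleftrightarrow> i < v \<and> j \<in> S_tgt A i"
  by (auto simp: S_src_def S_tgt_def)

section \<open>Ambiguous objects and the upper bounds\<close>

text \<open>In an alive parity the differences between two indistinguishable assignments must
  cancel, so no ambiguous object is alone in its tuple. Its ambiguous partner has another primary
  node, since a tuple holds one object per source. \<open>I\<close> collects the primary nodes of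
  the ambiguous objects.\<close>

lemma confusable_primaries:
  assumes legal: "legal_placement A k q P" and "\<not> permits_recovery A P F"
  obtains I where "I \<noteq> {}" "I \<subseteq> F" "I \<subseteq> {..<v}"
    "\<And>i. i \<in> I \<Longrightarrow> \<exists>T. card T = q \<and> T \<subseteq> S_tgt A i \<and>
       (\<forall>j\<in>T. j \<in> F \<or> (\<exists>i'\<in>I - {i}. j \<in> S_tgt A i'))"
proof -
  obtain w w' x where len: "data_assignment P w" "data_assignment P w'"
    and alive: "\<And>x. x \<in> objects P \<Longrightarrow> primary P x \<notin> F \<Longrightarrow> w x = w' x"
    and par: "\<And>j G. j < v \<Longrightarrow> j \<notin> F \<Longrightarrow> G \<in> tuples P j \<Longrightarrow> parity P w G = parity P w' G"
    and x: "x \<in> objects P" "w x \<noteq> w' x"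
    using assms(2) unfolding permits_recovery_def by auto
  \<comment> \<open>Fixing one bit position where the words differ reduces the argument to single
    bits.\<close>
  obtain t where t: "t < word_length P" "w x ! t \<noteq> w' x ! t"
    using x len unfolding data_assignment_def by (metis nth_equalityI)
  define D where "D = {y \<in> objects P. w y ! t \<noteq> w' y ! t}"
  have obj: "primary P y < v" "targets P y \<subseteq> S_tgt A (primary P y)" "card (targets P y) = q"
    if "y \<in> objects P" for y
    using legal that by (auto simp: legal_placement_def)
  have "\<exists>T. card T = q \<and> T \<subseteq> S_tgt A i \<and>
      (\<forall>j\<in>T. j \<in> F \<or> (\<exists>i'\<in>primary P ` D - {i}. j \<in> S_tgt A i'))"
    if i: "i \<in> primary P ` D" for i
  proof -
    obtain y where y: "y \<in> D" "i = primary P y"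
      using i by blast
    have yO: "y \<in> objects P"
      using y by (simp add: D_def)
    have "\<exists>i'\<in>primary P ` D - {i}. j \<in> S_tgt A i'" if j: "j \<in> targets P y" "j \<notin> F" for j
    proof -
      have jv: "j < v"
        using j obj(2)[OF yO] S_tgt_less by blast
      then have part: "partition_on (received P j) (tuples P j)"
        using legal by (simp add: legal_placement_def)
      have "y \<in> received P j"
        using yO j by (simp add: received_def)
      then obtain G where G: "G \<in> tuples P j" "y \<in> G"
        using part by (metis UnionE partition_onD1)
      have GO: "G \<subseteq> received P j"
        using part G by (metis Union_upper partition_onD1)
      then have "finite G"
        using legal by (auto simp: legal_placement_def received_def intro: finite_subset)
      have sum: "(\<Sum>z\<in>G. w z ! t) = (\<Sum>z\<in>G. w' z ! t)"
        using par[OF jv j(2) G(1)] t(1) by (simp add: parity_def)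
      \<comment> \<open>If \<open>y\<close> were the only member of \<open>D\<close> in
        \<open>G\<close>, cancelling the remaining equal sums would give equal bits at
        \<open>y\<close>.\<close>
      have "\<exists>z\<in>G - {y}. z \<in> D"
      proof (rule ccontr)
        assume "\<not> ?thesis"
        then have "w z ! t = w' z ! t" if "z \<in> G - {y}" for z
          using that GO by (auto simp: D_def received_def)
        then have "(\<Sum>z\<in>G - {y}. w z ! t) = (\<Sum>z\<in>G - {y}. w' z ! t)"
          by (intro sum.cong) auto
        then have "w y ! t = w' y ! t"
          using sum unfolding sum.remove[OF \<open>finite G\<close> G(2)] by (simp only: add_right_cancel)
        then show False
          using y by (simp add: D_def)
      qed
      then obtain z where z: "z \<in> G" "z \<noteq> y" "z \<in> D"
        by blast
      have zt: "z \<in> objects P" "j \<in> targets P z"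
        using z GO by (auto simp: received_def)
      have "i \<in> S_src A j"
        using S_src_iff[OF jv] obj[OF yO] y j by auto
      then have "\<exists>!u. u \<in> G \<and> primary P u = i"
        using legal jv G(1) by (simp add: legal_placement_def)
      then have "primary P z \<noteq> i"
        using z(1,2) G(2) y(2) by metis
      then show ?thesis
        using z zt obj(2)[OF zt(1)] by blast
    qed
    then show ?thesis
      using obj[OF yO] y(2) by blast
  qed
  moreover have "primary P ` D \<noteq> {}"
    using x t by (auto simp: D_def)
  moreover have "primary P y \<in> F" if "y \<in> D" for y
    using alive[of y] that by (metis (mono_tags, lifting) D_def mem_Collect_eq)
  moreover have "primary P ` D \<subseteq> {..<v}"
    using obj(1) by (auto simp: D_def)
  ultimately show thesis
    by (intro that[of "primary P ` D"]) auto
qed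

text \<open>For distinct \<open>i\<close> in \<open>I\<close> these sets are disjoint subsets of
  \<open>F\<close>, so their sizes add up to at most \<open>card F\<close>.\<close>

definition private_targets :: "nat set \<Rightarrow> nat set \<Rightarrow> nat \<Rightarrow> nat set" where
  "private_targets F I i = {j \<in> F. j \<in> S_tgt A i \<and> (\<forall>i'\<in>I - {i}. j \<notin> S_tgt A i')}"

text \<open>The \<open>q\<close> targets of an ambiguous object of \<open>i\<close> are covered by
  the private targets of \<open>i\<close> and the \<open>card I - 1\<close> intersections with other
  target sets, each of size \<open>l\<close>.\<close>

lemma many_private_targets:
  assumes "legal_placement A k q P" "\<not> permits_recovery A P F" "finite F"
  obtains I where "I \<noteq> {}" "I \<subseteq> F"
    "\<And>i. i \<in> I \<Longrightarrow> q \<le> l * (card I - 1) + card (private_targets F I i)"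
proof -
  obtain I where I: "I \<noteq> {}" "I \<subseteq> F" "I \<subseteq> {..<v}"
    and T: "\<And>i. i \<in> I \<Longrightarrow> \<exists>T. card T = q \<and> T \<subseteq> S_tgt A i \<and>
       (\<forall>j\<in>T. j \<in> F \<or> (\<exists>i'\<in>I - {i}. j \<in> S_tgt A i'))"
    using confusable_primaries[OF assms(1,2)] by metis
  have "q \<le> l * (card I - 1) + card (private_targets F I i)" if i: "i \<in> I" for i
  proof -
    obtain T where T: "card T = q" "T \<subseteq> S_tgt A i"
        "\<forall>j\<in>T. j \<in> F \<or> (\<exists>i'\<in>I - {i}. j \<in> S_tgt A i')"
      using T[OF i] by blast
    let ?U = "\<Union>i'\<in>I - {i}. S_tgt A i \<inter> S_tgt A i'"
    have finI: "finite I"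
      using I(3) finite_subset by blast
    \<comment> \<open>An alive target is shared with some other node of \<open>I\<close>; a failed
      one is either shared or private.\<close>
    have "T \<subseteq> ?U \<union> private_targets F I i"
      using T by (auto simp: private_targets_def)
    then have "q \<le> card (?U \<union> private_targets F I i)"
      unfolding T(1)[symmetric]
      using finI \<open>finite F\<close> by (intro card_mono) (auto simp: private_targets_def)
    also have "\<dots> \<le> card ?U + card (private_targets F I i)"
      by (rule card_Un_le)
    also have "card ?U \<le> (\<Sum>i'\<in>I - {i}. card (S_tgt A i \<inter> S_tgt A i'))"
      using finI by (intro card_UN_le) auto
    also have "\<dots> = (\<Sum>i'\<in>I - {i}. l)"
      using I(3) i by (intro sum.cong card_common_targets) auto
    also have "\<dots> = l * (card I - 1)"
      using finI i by simp
    finally show ?thesis by simp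
  qed
  then show thesis
    using that I by blast
qed

text \<open>With \<open>card I = s + 1\<close> and \<open>p = s + 1 + d\<close>, each node of
  \<open>I\<close> has at least \<open>d + 2\<close> private targets. Then \<open>F\<close> has at
  least \<open>(s + 1) * (d + 2)\<close> elements, which exceeds \<open>p\<close>.\<close>

lemma universally_recoverable_upper:
  assumes "p \<ge> 2"
  shows "universally_recoverable A k p (l * (p - 1) + 2)"
proof (unfold universally_recoverable_def, intro allI impI, rule ccontr)
  fix P F
  assume legal: "legal_placement A k (l * (p - 1) + 2) P"
    and F: "F \<subseteq> {..<dim_row A} \<and> card F \<le> p" and not: "\<not> permits_recovery A P F"
  have finF: "finite F"
    using F finite_subset by blast
  obtain I where I: "I \<noteq> {}" "I \<subseteq> F"
    and pr: "\<And>i. i \<in> I \<Longrightarrow> l * (p - 1) + 2 \<le> l * (card I - 1) + card (private_targets F I i)"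
    using many_private_targets[OF legal not finF] by metis
  have finI: "finite I"
    using I(2) finF finite_subset by blast
  have I_le: "card I \<le> p"
    using card_mono[OF finF I(2)] F by simp
  have I_pos: "card I \<ge> 1"
    using I(1) finI by (simp add: Suc_le_eq card_gt_0_iff)
  obtain d where d: "p = card I + d"
    using I_le le_Suc_ex by blast
  obtain s where s: "card I = Suc s"
    using I_pos by (cases "card I") auto
  have "d + 2 \<le> card (private_targets F I i)" if "i \<in> I" for i
  proof -
    \<comment> \<open>Here \<open>l * (p - 1)\<close> equals
      \<open>l * (card I - 1) + l * d\<close>, and the first summand cancels.\<close>
    have "l * d + 2 \<le> card (private_targets F I i)"
      using pr[OF that] d s by (simp add: algebra_simps)
    moreover have "d \<le> l * d"
      using parameters(1) by simp
    ultimately show ?thesis by linarith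
  qed
  then have "card I * (d + 2) \<le> (\<Sum>i\<in>I. card (private_targets F I i))"
    using sum_mono[of I "\<lambda>_. d + 2"] by simp
  also have "\<dots> = card (\<Union>i\<in>I. private_targets F I i)"
    using finI finF by (intro card_UN_disjoint[symmetric]) (auto simp: private_targets_def)
  also have "\<dots> \<le> card F"
    using finF by (intro card_mono) (auto simp: private_targets_def)
  finally show False
    using F d s by (simp add: algebra_simps)
qed

text \<open>Here \<open>F = I = {i}\<close>, so nothing is shared, and the only possible private
  target would be \<open>i\<close> itself, which the zero diagonal excludes.\<close>

lemma universally_recoverable_single:
  "universally_recoverable A k 1 1"
proof (unfold universally_recoverable_def, intro allI impI, rule ccontr)
  fix P F
  assume legal: "legal_placement A k 1 P"
    and F: "F \<subseteq> {..<dim_row A} \<and> card F \<le> 1" and not: "\<not> permits_recovery A P F"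
  have finF: "finite F"
    using F finite_subset by blast
  obtain I where I: "I \<noteq> {}" "I \<subseteq> F"
    and pr: "\<And>i. i \<in> I \<Longrightarrow> 1 \<le> l * (card I - 1) + card (private_targets F I i)"
    using many_private_targets[OF legal not finF] by metis
  then obtain i where i: "i \<in> I" by blast
  have "F = {i}"
    using F i I(2) finF card_le_Suc0_iff_eq[OF finF] by auto
  moreover from this have "I = {i}"
    using i I(2) by blast
  moreover have "private_targets {i} {i} i = {}"
    using not_own_target by (auto simp: private_targets_def)
  ultimately show False
    using pr[OF i] by simp
qed

section \<open>The complete placement\<close>

text \<open>Every source of \<open>j\<close> sends \<open>j\<close> the same number \<open>N\<close>
  of replicas. Enumerating them source by source, the \<open>n\<close>-th tuple takes the
  \<open>n\<close>-th replica from each source. \<open>T0\<close> marks one object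
  \<open>f i\<close> per node; enumerations start with marked objects, so those received at
  \<open>j\<close> share the tuple with index 0.\<close>

lemma complete_placement:
  assumes T0: "\<And>i. i < v \<Longrightarrow> T0 i \<subseteq> S_tgt A i \<and> card (T0 i) = q"
  obtains P f where "legal_placement A k q P" "word_length P = 1"
    "\<And>i. i < v \<Longrightarrow> f i \<in> objects P \<and> primary P (f i) = i \<and> targets P (f i) = T0 i"
    "\<And>j. j < v \<Longrightarrow> \<exists>i<v. j \<in> T0 i \<Longrightarrow>
       \<exists>G\<in>tuples P j. \<forall>i<v. j \<in> T0 i \<longrightarrow> f i \<in> G"
proof -
  define X where "X = (SIGMA i:{..<v}. {T. T \<subseteq> S_tgt A i \<and> card T = q})"
  have "finite X"
    unfolding X_def by (intro finite_SigmaI) auto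
  then obtain e :: "nat \<Rightarrow> nat \<times> nat set" where e: "bij_betw e {..<card X} X"
    using ex_bij_betw_nat_finite by (auto simp: atLeast0LessThan)
  \<comment> \<open>\<open>R j h\<close> is the set of objects that \<open>h\<close> replicates to
    \<open>j\<close>.\<close>
  define R where "R j h = {x \<in> {..<card X}. fst (e x) = h \<and> j \<in> snd (e x)}" for j h
  \<comment> \<open>The case \<open>q = 0\<close> is separate because truncated subtraction would
    turn the binomial into 1, while no replica is sent.\<close>
  define N where "N = (if q = 0 then 0 else (k - 1) choose (q - 1))"
  define f where "f i = inv_into {..<card X} e (i, T0 i)" for i
  have eX: "fst (e x) < v" "snd (e x) \<subseteq> S_tgt A (fst (e x))" "card (snd (e x)) = q"
    if "x < card X" for x
  proof -
    have "e x \<in> X"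
      using e that by (auto simp: bij_betw_def)
    then show "fst (e x) < v" "snd (e x) \<subseteq> S_tgt A (fst (e x))" "card (snd (e x)) = q"
      by (auto simp: X_def)
  qed
  have f: "f i < card X" "e (f i) = (i, T0 i)" if "i < v" for i
  proof -
    have "(i, T0 i) \<in> e ` {..<card X}"
      using T0 that e by (auto simp: X_def bij_betw_def)
    then show "f i < card X" "e (f i) = (i, T0 i)"
      using inv_into_into[of "(i, T0 i)" e "{..<card X}"]
        f_inv_into_f[of "(i, T0 i)" e "{..<card X}"]
      by (simp_all add: f_def)
  qed
  have card_R: "card (R j h) = N" if "j < v" "h \<in> S_src A j" for j h
  proof -
    have h: "h < v" "j \<in> S_tgt A h"
      using S_src_iff that by auto
    let ?Y = "{T. T \<subseteq> S_tgt A h \<and> card T = q \<and> j \<in> T}"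
    have "bij_betw (snd \<circ> e) (R j h) ?Y"
    proof (rule bij_betwI')
      show "\<And>x y. x \<in> R j h \<Longrightarrow> y \<in> R j h \<Longrightarrow> ((snd \<circ> e) x = (snd \<circ> e) y) = (x = y)"
        using e by (auto simp: R_def bij_betw_def inj_on_def prod_eq_iff)
      show "\<And>x. x \<in> R j h \<Longrightarrow> (snd \<circ> e) x \<in> ?Y"
        using eX by (auto simp: R_def)
      fix T assume T: "T \<in> ?Y"
      then have "(h, T) \<in> e ` {..<card X}"
        using h e by (auto simp: X_def bij_betw_def)
      then obtain x where x: "x < card X" "e x = (h, T)"
        by auto
      then show "\<exists>x\<in>R j h. T = (snd \<circ> e) x"
        using T by (auto simp: R_def intro!: bexI[of _ x])
    qed
    then have "card (R j h) = card ?Y"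
      by (rule bij_betw_same_card)
    also have "\<dots> = N"
    proof (cases q)
      case 0
      then have "?Y = {}"
        using finite_subset[OF _ finite_S_tgt[of h]] by auto
      then show ?thesis
        using 0 by (simp add: N_def)
    next
      case (Suc q')
      then show ?thesis
        using card_subsets_containing[OF finite_S_tgt h(2), of q'] card_S_tgt[OF h(1)]
        by (simp add: N_def)
    qed
    finally show ?thesis .
  qed
  have "\<exists>b. bij_betw b {..<card (R j h)} (R j h) \<and> (f h \<in> R j h \<longrightarrow> b 0 = f h)" for j h
    by (rule bij_betw_lessThan_card) (simp add: R_def)
  then obtain b where b': "\<And>j h. bij_betw (b j h) {..<card (R j h)} (R j h)"
    and b0: "\<And>j h. f h \<in> R j h \<Longrightarrow> b j h 0 = f h"
    by metis
  have b: "bij_betw (b j h) {..<N} (R j h)" if "j < v" "h \<in> S_src A j" for j h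
    using b'[of j h] card_R[OF that] by simp
  define G where "G j n = (\<lambda>h. b j h n) ` S_src A j" for j n
  define P where "P = \<lparr>word_length = 1, objects = {..<card X}, primary = fst \<circ> e,
    targets = snd \<circ> e, tuples = (\<lambda>j. G j ` {..<N})\<rparr>"
  have bR: "b j h n < card X" "fst (e (b j h n)) = h" "j \<in> snd (e (b j h n))"
    if "j < v" "h \<in> S_src A j" "n < N" for j h n
    using bij_betwE[OF b[OF that(1,2)]] that(3) by (auto simp: R_def)
  have received: "received P j = \<Union> (G j ` {..<N})" if j: "j < v" for j
  proof (intro equalityI subsetI)
    fix x assume "x \<in> received P j"
    then have x: "x < card X" "j \<in> snd (e x)"
      by (auto simp: received_def P_def)
    then have h: "fst (e x) \<in> S_src A j"
      using S_src_iff[OF j] eX[OF x(1)] by blast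
    have "x \<in> R j (fst (e x))"
      using x by (simp add: R_def)
    then obtain n where "n < N" "x = b j (fst (e x)) n"
      using b[OF j h] by (auto simp: bij_betw_def)
    then show "x \<in> \<Union> (G j ` {..<N})"
      using h by (auto simp: G_def)
  next
    fix x assume "x \<in> \<Union> (G j ` {..<N})"
    then show "x \<in> received P j"
      using bR[OF j] by (auto simp: G_def received_def P_def)
  qed
  \<comment> \<open>The primary node of a common element determines \<open>h\<close>, and
    injectivity of \<open>b j h\<close> then gives \<open>n = m\<close>.\<close>
  have inter: "G j n \<inter> G j m = {}" if j: "j < v" "n < N" "m < N" "n \<noteq> m" for j n m
  proof (rule ccontr)
    assume "G j n \<inter> G j m \<noteq> {}"
    then obtain h h' where h: "h \<in> S_src A j" "h' \<in> S_src A j" "b j h n = b j h' m"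
      by (auto simp: G_def)
    then have "h = h'"
      using bR(2) j by metis
    then show False
      using h b[OF j(1) h(1)] j by (auto simp: bij_betw_def inj_on_def)
  qed
  have src_ne: "S_src A j \<noteq> {}" if "j < v" for j
    using card_S_src[OF that] parameters by auto
  have part: "partition_on (received P j) (tuples P j)" if j: "j < v" for j
  proof (rule partition_onI)
    show "\<Union> (tuples P j) = received P j"
      using received[OF j] by (simp add: P_def)
    show "disjnt p p'" if "p \<in> tuples P j" "p' \<in> tuples P j" "p \<noteq> p'" for p p'
      using that inter[OF j] unfolding disjnt_def P_def by auto
    show "{} \<notin> tuples P j"
      using src_ne[OF j] by (auto simp: P_def G_def)
  qed
  have card_G: "card (G j n) = k" if "j < v" "n < N" for j n
  proof -
    have "inj_on (\<lambda>h. b j h n) (S_src A j)"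
      by (rule inj_on_inverseI[where g = "fst \<circ> e"]) (use bR that in auto)
    then show ?thesis
      using card_S_src[OF that(1)] by (simp add: G_def card_image)
  qed
  have one: "\<exists>!x. x \<in> G j n \<and> fst (e x) = h" if "j < v" "n < N" "h \<in> S_src A j" for j n h
    using bR(2)[OF that(1) _ that(2)] that(3)
    by (intro ex1I[of _ "b j h n"]) (auto simp: G_def)
  have "legal_placement A k q P"
    unfolding legal_placement_def
    using part card_G one eX by (auto simp: P_def)
  moreover have "word_length P = 1"
    by (simp add: P_def)
  moreover have "f i \<in> objects P \<and> primary P (f i) = i \<and> targets P (f i) = T0 i" if "i < v" for i
    using f[OF that] by (simp add: P_def)
  moreover have "\<exists>G\<in>tuples P j. \<forall>i<v. j \<in> T0 i \<longrightarrow> f i \<in> G"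
    if j: "j < v" "\<exists>i<v. j \<in> T0 i" for j
  proof -
    have mem: "i \<in> S_src A j" "f i \<in> R j i" if "i < v" "j \<in> T0 i" for i
      using S_src_iff[OF j(1)] T0 that f by (auto simp: R_def)
    obtain i where i: "i < v" "j \<in> T0 i"
      using j(2) by blast
    \<comment> \<open>A marked object received at \<open>j\<close> shows that a tuple with index 0
      exists.\<close>
    have "0 < card (R j i)"
      using mem(2)[OF i] by (auto simp: card_gt_0_iff R_def)
    then have "0 < N"
      using card_R[OF j(1) mem(1)[OF i]] by simp
    moreover have "f i' \<in> G j 0" if "i' < v" "j \<in> T0 i'" for i'
      using mem[OF that] b0 by (metis G_def image_eqI)
    ultimately show ?thesis
      by (auto simp: P_def)
  qed
  ultimately show thesis
    using that by blast
qed

section \<open>Failure sets for the lower bounds\<close>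

lemma legal_tupleD:
  assumes "legal_placement A k q P" "j < v" "G \<in> tuples P j"
  shows "finite G" "\<And>x. x \<in> G \<Longrightarrow> j \<in> targets P x"
proof -
  have "partition_on (received P j) (tuples P j)"
    using assms by (simp add: legal_placement_def)
  then have *: "G \<subseteq> received P j"
    using assms(3) by (metis Union_upper partition_onD1)
  then show "\<And>x. x \<in> G \<Longrightarrow> j \<in> targets P x"
    by (auto simp: received_def)
  show "finite G"
    using * assms(1) by (auto simp: legal_placement_def received_def intro: finite_subset)
qed

text \<open>Node 0 and the \<open>q\<close> targets of \<open>f 0\<close> make at most
  \<open>p\<close> failures, and no alive parity involves \<open>f 0\<close>.\<close>

lemma not_universally_recoverable_all_targets_fail:
  assumes "q < p" "q \<le> k"
  shows "\<not> universally_recoverable A k p q"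
proof
  assume univ: "universally_recoverable A k p q"
  have "\<exists>T. T \<subseteq> S_tgt A i \<and> card T = q" if "i < v" for i
    using obtain_subset_with_card_n[of q "S_tgt A i"] card_S_tgt[OF that] assms(2) by metis
  then obtain T0 where T0: "\<And>i. i < v \<Longrightarrow> T0 i \<subseteq> S_tgt A i \<and> card (T0 i) = q"
    by metis
  obtain P f where P: "legal_placement A k q P" "word_length P = 1"
    and f: "\<And>i. i < v \<Longrightarrow> f i \<in> objects P \<and> primary P (f i) = i \<and> targets P (f i) = T0 i"
    using complete_placement[OF T0] by metis
  have v: "0 < v"
    using parameters by simp
  define F where "F = insert 0 (T0 0)"
  have "F \<subseteq> {..<v}"
    using T0[OF v] v S_tgt_less by (auto simp: F_def)
  moreover have "card F \<le> p"
    using T0[OF v] assms(1) card_insert_le_m1[of p "T0 0" 0] by (simp add: F_def)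
  ultimately have "permits_recovery A P F"
    using univ P(1) by (simp add: universally_recoverable_def)
  moreover have "\<not> permits_recovery A P F"
  proof (rule not_permits_recoveryI[where D = "{f 0}"])
    show "even (card (G \<inter> {f 0}))" if "j < dim_row A" "j \<notin> F" "G \<in> tuples P j" for j G
    proof -
      have "f 0 \<notin> G"
        using legal_tupleD(2)[OF P(1) _ that(3), of "f 0"] that f[OF v] by (auto simp: F_def)
      then show ?thesis by simp
    qed
  qed (use P f[OF v] legal_tupleD(1)[OF P(1)] in \<open>auto simp: F_def\<close>)
  ultimately show False by contradiction
qed

text \<open>Nodes 0 and 1 have \<open>l\<close> common targets, enough for \<open>f 0\<close> and
  \<open>f 1\<close> to use the same set \<open>T\<close>. At each node of \<open>T\<close> both lie
  in one tuple, so changing both bits leaves every parity unchanged.\<close>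

lemma not_universally_recoverable_common_targets:
  assumes "2 \<le> p" "q \<le> l"
  shows "\<not> universally_recoverable A k p q"
proof
  assume univ: "universally_recoverable A k p q"
  have v: "0 < v" "1 < v"
    using parameters by auto
  obtain T where T: "T \<subseteq> S_tgt A 0 \<inter> S_tgt A 1" "card T = q"
    using obtain_subset_with_card_n[of q "S_tgt A 0 \<inter> S_tgt A 1"] card_common_targets[OF v] assms(2)
    by (metis zero_neq_one)
  have "\<exists>T'. T' \<subseteq> S_tgt A i \<and> card T' = q \<and> (i \<le> 1 \<longrightarrow> T' = T)" if "i < v" for i
  proof (cases "i \<le> 1")
    case True
    then have "i = 0 \<or> i = 1" by linarith
    then show ?thesis using T by auto
  next
    case False
    then show ?thesis
      using obtain_subset_with_card_n[of q "S_tgt A i"] card_S_tgt[OF that] assms(2) parameters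
      by (metis le_trans less_imp_le)
  qed
  then obtain T0 where T0: "\<And>i. i < v \<Longrightarrow> T0 i \<subseteq> S_tgt A i \<and> card (T0 i) = q"
    and T01: "\<And>i. i < v \<Longrightarrow> i \<le> 1 \<Longrightarrow> T0 i = T"
    by metis
  obtain P f where P: "legal_placement A k q P" "word_length P = 1"
    and f: "\<And>i. i < v \<Longrightarrow> f i \<in> objects P \<and> primary P (f i) = i \<and> targets P (f i) = T0 i"
    and together: "\<And>j. j < v \<Longrightarrow> \<exists>i<v. j \<in> T0 i \<Longrightarrow>
       \<exists>G\<in>tuples P j. \<forall>i<v. j \<in> T0 i \<longrightarrow> f i \<in> G"
    using complete_placement[OF T0] by metis
  \<comment> \<open>Different primary nodes make the pair have exactly two elements, an even
    number.\<close>
  have neq: "f 0 \<noteq> f 1"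
    using f v by (metis zero_neq_one)
  have "permits_recovery A P {0, 1}"
    using univ P(1) v assms(1) by (simp add: universally_recoverable_def)
  moreover have "\<not> permits_recovery A P {0, 1}"
  proof (rule not_permits_recoveryI[where D = "{f 0, f 1}"])
    show "even (card (G \<inter> {f 0, f 1}))"
      if j: "j < dim_row A" "j \<notin> {0, 1}" and G: "G \<in> tuples P j" for j G
    proof (cases "j \<in> T")
      case True
      have jv: "j < v" using j by simp
      then obtain G' where G': "G' \<in> tuples P j" "f 0 \<in> G'" "f 1 \<in> G'"
        using together[OF jv] T01[OF v(1)] T01[OF v(2)] True v by auto
      \<comment> \<open>As \<open>G'\<close> contains both objects, disjointness keeps both out of
        every other tuple at \<open>j\<close>.\<close>
      have "disjoint (tuples P j)"
        using P(1) jv by (simp add: legal_placement_def partition_on_def)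
      then have "G = G' \<or> G \<inter> G' = {}"
        using G G'(1) by (auto dest: disjointD)
      then have "G \<inter> {f 0, f 1} = {f 0, f 1} \<or> G \<inter> {f 0, f 1} = {}"
        using G' by auto
      then show ?thesis
        using neq by auto
    next
      case False
      then have "f 0 \<notin> G" "f 1 \<notin> G"
        using legal_tupleD(2)[OF P(1) _ G, of "f 0"] legal_tupleD(2)[OF P(1) _ G, of "f 1"]
          j(1) f[OF v(1)] f[OF v(2)] T01[OF v(1)] T01[OF v(2)] by auto
      then show ?thesis by simp
    qed
  qed (use P f v legal_tupleD(1)[OF P(1)] in auto)
  ultimately show False by contradiction
qed

section \<open>Bounds on the threshold\<close>

text \<open>The witness \<open>u\<close> makes \<open>LEAST\<close> meaningful:
  \<open>q_star\<close> itself is then recoverable and at most \<open>k\<close>, so it cannot lie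
  below \<open>m\<close>.\<close>

lemma q_star_bounds:
  assumes "universally_recoverable A k p u" "u \<le> k"
    and "\<And>q. q \<le> k \<Longrightarrow> q < m \<Longrightarrow> \<not> universally_recoverable A k p q"
  shows "threshold_exists A k p" "m \<le> q_star A k p" "q_star A k p \<le> u"
proof -
  let ?Q = "\<lambda>q. q \<in> {0..k} \<and> universally_recoverable A k p q"
  have u: "?Q u"
    using assms by simp
  then show "threshold_exists A k p"
    by (auto simp: threshold_exists_def)
  show "q_star A k p \<le> u"
    unfolding q_star_def using u by (rule Least_le)
  have "?Q (q_star A k p)"
    unfolding q_star_def using u by (rule LeastI)
  then show "m \<le> q_star A k p"
    using assms(3) by (meson atLeastAtMost_iff not_less)
qed

lemma q_star_single: "threshold_exists A k 1" "q_star A k 1 = 1"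
proof -
  have k: "1 \<le> k"
    using parameters by simp
  note bounds = q_star_bounds[OF universally_recoverable_single k,
      OF not_universally_recoverable_all_targets_fail]
  show "threshold_exists A k 1"
    by (rule bounds) auto
  have "1 \<le> q_star A k 1" "q_star A k 1 \<le> 1"
    by (rule bounds; auto)+
  then show "q_star A k 1 = 1" by simp
qed

lemma q_star_multiple:
  assumes "2 \<le> p" "l * (p - 1) + 2 \<le> k"
  shows "threshold_exists A k p" "max p (l + 1) \<le> q_star A k p"
    "q_star A k p \<le> l * (p - 1) + 2"
proof -
  have lower: "\<not> universally_recoverable A k p q" if "q \<le> k" "q < max p (l + 1)" for q
  \<comment> \<open>Below the maximum, either \<open>q < p\<close> or \<open>q \<le> l\<close>, and
    each case has its own failure set.\<close>
  proof (cases "q < p")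
    case True
    then show ?thesis
      using that by (intro not_universally_recoverable_all_targets_fail)
  next
    case False
    then show ?thesis
      using that assms(1) by (intro not_universally_recoverable_common_targets) auto
  qed
  note bounds = q_star_bounds[where m = "max p (l + 1)",
      OF universally_recoverable_upper[OF assms(1)] assms(2) lower]
  show "threshold_exists A k p" "max p (l + 1) \<le> q_star A k p"
    "q_star A k p \<le> l * (p - 1) + 2"
    by (rule bounds; assumption)+
qed

end

section \<open>From the abstract design to its matrix\<close>

text \<open>The labelings are bijections, so counting indices in a row or column amounts to counting
  blocks through a point or points on a block.\<close>

lemma representative_zero_diagonal_design:
  assumes sb: "sbibd v k l points blocks lies_in"
    and rep: "representative v points blocks lies_in A"
    and zd: "zero_diagonal A"
  shows "zero_diagonal_design A v k l"
proof -
  obtain pt bl where A: "A \<in> carrier_mat v v"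
    and pt: "bij_betw pt {..<v} points" and bl: "bij_betw bl {..<v} blocks"
    and ent: "\<And>i j. i < v \<Longrightarrow> j < v \<Longrightarrow> A $$ (i, j) = (if lies_in (pt i) (bl j) then 1 else 0)"
    using rep unfolding representative_def by blast
  have dim [simp]: "dim_row A = v" "dim_col A = v"
    using A by auto
  have transfer: "card {i. i < v \<and> Q (g i)} = card {y \<in> B. Q y}"
    if "bij_betw g {..<v} B" for g :: "nat \<Rightarrow> 'c" and B Q
  proof -
    have "bij_betw g {i. i < v \<and> Q (g i)} {y \<in> B. Q y}"
      using that by (auto simp: bij_betw_def inj_on_def)
    then show ?thesis by (rule bij_betw_same_card)
  qed
  have tgt: "S_tgt A i = {j. j < v \<and> lies_in (pt i) (bl j)}" if "i < v" for i
    using ent[OF that] by (auto simp: S_tgt_def split: if_splits)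
  have src: "S_src A j = {i. i < v \<and> lies_in (pt i) (bl j)}" if "j < v" for j
    using ent that by (auto simp: S_src_def split: if_splits)
  have ptv: "pt i \<in> points" "bl i \<in> blocks" if "i < v" for i
    using that bij_betwE[OF pt] bij_betwE[OF bl] by auto
  show ?thesis
  proof
    show "A \<in> carrier_mat v v" by (rule A)
    show "1 \<le> l" "l < k" "k < v"
      using sb by (auto simp: sbibd_def)
    show "card (S_tgt A i) = k" if "i < v" for i
      using sb ptv[OF that] transfer[OF bl, of "\<lambda>b. lies_in (pt i) b"]
      by (simp add: tgt[OF that] sbibd_def)
    show "card (S_src A j) = k" if "j < v" for j
      using sb ptv[OF that] transfer[OF pt, of "\<lambda>x. lies_in x (bl j)"]
      by (simp add: src[OF that] sbibd_def)
    show "card (S_tgt A i \<inter> S_tgt A i') = l" if "i < v" "i' < v" "i \<noteq> i'" for i i'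
    proof -
      have "pt i \<noteq> pt i'"
        using pt that by (auto simp: bij_betw_def inj_on_def)
      moreover have "S_tgt A i \<inter> S_tgt A i' =
          {j. j < v \<and> lies_in (pt i) (bl j) \<and> lies_in (pt i') (bl j)}"
        using that tgt by auto
      ultimately show ?thesis
        using sb ptv that transfer[OF bl, of "\<lambda>b. lies_in (pt i) b \<and> lies_in (pt i') b"]
        by (simp add: sbibd_def)
    qed
    show "i \<notin> S_tgt A i" for i
      using zd by (auto simp: zero_diagonal_def S_tgt_def)
  qed
qed

theorem mainTheorem2:
  fixes v k l :: nat
    and points :: "'a set" and blocks :: "'b set" and lies_in :: "'a \<Rightarrow> 'b \<Rightarrow> bool"
    and A :: "nat mat"
  assumes "sbibd v k l points blocks lies_in"
    and "representative v points blocks lies_in A"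
    and "zero_diagonal A"
  shows "(1 \<le> k \<longrightarrow> threshold_exists A k 1 \<and> q_star A k 1 = 1) \<and>
    (\<forall>p\<ge>2. k \<ge> l * (p - 1) + 2 \<longrightarrow>
       threshold_exists A k p \<and>
       max p (l + 1) \<le> q_star A k p \<and> q_star A k p \<le> l * (p - 1) + 2) \<and>
    (k \<ge> l + 2 \<longrightarrow>
       threshold_exists A k 2 \<and> l + 1 \<le> q_star A k 2 \<and> q_star A k 2 \<le> l + 2)"
proof -
  interpret zero_diagonal_design A v k l
    using assms by (rule representative_zero_diagonal_design)
  show ?thesis
    \<comment> \<open>The last conjunct is the case \<open>p = 2\<close>, where
      \<open>l * (p - 1) + 2\<close> is \<open>l + 2\<close>.\<close>
    using q_star_single q_star_multiple q_star_multiple[of 2] by auto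
qed

end
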